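(* Let $R$ be an integral domain with field of fractions $K$, and let $\|\cdot\|\colon R\to\mathbb{N}$ be a discrete multiplicative norm on $R$, extended to a multiplicative norm $\|\cdot\|\colon K\to\mathbb{Q}_{\geq 0}$ on $K$. Let $d>0$ be an integer and let $f=f_2+f_1+f_0\in R[X_1,\dots,X_d]$, where $f_i$ is homogeneous of degree $i$ for $i=0,1,2$, and $f_2$ is Euclidean with respect to $\|\cdot\|$. If $f$ has a zero in $K^d$, then $f$ has a zero in $R^d$.
   Context: Here $\mathbb{N}$ denotes the non-negative integers (including $0$). A discrete multiplicative norm on a commutative ring $R$ with unity $1\neq 0$ is a mapping $\|\cdot\|\colon R\to\mathbb{N}$ such that (N0) for every $x\in R$, $\|x\|=0$ if and only if $x=0$; and (N1) for all $x,y\in R$, $\|xy\|=\|x\|\,\|y\|$. If $R$ is an integral domain with field of fractions $K$, such a norm extends in a unique way to a mapping $\|\cdot\|\colon K\to\mathbb{Q}_{\geq 0}$ satisfying (N1) on $K$ (and then also (N0)), namely $\|a/b\|=\|a\|/\|b\|$ for $a,b\in R$, $b\neq 0$; this extended mapping is again written $\|\cdot\|$. A form over $R$ is a homogeneous polynomial in $R[X_1,\dots,X_d]$ with $d>0$. A form $g$ over $R$ in $d$ variables, of any degree, is Euclidean with respect to the norm $\|\cdot\|$ if for every $x\in K^d\setminus R^d$ there exists $y\in R^d$ such that $0<\|g(x-y)\|<1$. No restriction is imposed on the characteristic of $R$. *)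

theory Defs
  imports
    "HOL-Analysis.Finite_Cartesian_Product"
    "HOL-Library.Poly_Mapping"
    "HOL-Computational_Algebra.Fraction_Field"
begin

definition discrete_mult_norm :: "('a::comm_ring_1 \<Rightarrow> nat) \<Rightarrow> bool" where
  "discrete_mult_norm N \<longleftrightarrow>
     (\<forall>x. N x = 0 \<longleftrightarrow> x = 0) \<and> (\<forall>x y. N (x * y) = N x * N y)"

text \<open>
  The extension of a norm to the field of fractions. The description is well defined only if
  \<open>N\<close> is a discrete multiplicative norm; the lemmas below show that it then is the
  unique multiplicative extension of \<open>N\<close>.
\<close>

definition fract_norm :: "('a::idom \<Rightarrow> nat) \<Rightarrow> 'a fract \<Rightarrow> rat" where
  "fract_norm N q =
     (THE r. \<forall>a b. b \<noteq> 0 \<longrightarrow> q = Fract a b \<longrightarrow> r = of_nat (N a) / of_nat (N b))"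

definition to_fract :: "'a::idom \<Rightarrow> 'a fract" where
  "to_fract a = Fract a 1"

lemma fract_norm_Fract:
  assumes "discrete_mult_norm N" and "b \<noteq> 0"
  shows "fract_norm N (Fract a b) = of_nat (N a) / of_nat (N b)"
proof -
  have N0: "N x = 0 \<longleftrightarrow> x = 0" and N1: "N (x * y) = N x * N y" for x y
    using assms(1) unfolding discrete_mult_norm_def by (simp, blast)
  have *: "(of_nat (N a) / of_nat (N b) :: rat) = of_nat (N a') / of_nat (N b')"
    if "b' \<noteq> 0" "Fract a b = Fract a' b'" for a' b'
  proof -
    have "N a * N b' = N a' * N b"
      using that assms(2) by (simp add: eq_fract flip: N1)
    then have "(of_nat (N a) * of_nat (N b') :: rat) = of_nat (N a') * of_nat (N b)"
      by (metis of_nat_mult)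
    then show ?thesis
      using that(1) assms(2) by (simp add: N0 frac_eq_eq)
  qed
  show ?thesis
    unfolding fract_norm_def using assms(2) * by (intro the_equality) blast+
qed

lemma fract_norm_to_fract:
  assumes "discrete_mult_norm N"
  shows "fract_norm N (to_fract a) = of_nat (N a)"
proof -
  have "N 1 * N 1 = N 1" "N 1 \<noteq> 0"
    using assms unfolding discrete_mult_norm_def by (metis mult_1, simp)
  then have "N 1 = 1" by simp
  then show ?thesis
    unfolding to_fract_def by (simp add: fract_norm_Fract[OF assms])
qed

lemma fract_norm_mult:
  assumes "discrete_mult_norm N"
  shows "fract_norm N (p * q) = fract_norm N p * fract_norm N q"
proof -
  have N1: "N (x * y) = N x * N y" for x y
    using assms unfolding discrete_mult_norm_def by blast
  obtain a b c d where "p = Fract a b" "b \<noteq> 0" "q = Fract c d" "d \<noteq> 0"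
    by (metis Fract_cases)
  then show ?thesis
    by (simp add: fract_norm_Fract[OF assms] N1)
qed

lemma fract_norm_unique:
  fixes M :: "'a::idom fract \<Rightarrow> rat"
  assumes "discrete_mult_norm N"
    and "\<And>p q. M (p * q) = M p * M q" and "\<And>a. M (to_fract a) = of_nat (N a)"
  shows "M = fract_norm N"
proof
  fix q :: "'a fract"
  obtain a b where q: "q = Fract a b" "b \<noteq> 0"
    by (metis Fract_cases)
  have "q * to_fract b = to_fract a"
    using q by (simp add: eq_fract to_fract_def)
  then have "M q * of_nat (N b) = of_nat (N a)"
    by (metis assms(2,3))
  moreover have "N b \<noteq> 0"
    using assms(1) q(2) unfolding discrete_mult_norm_def by blast
  ultimately show "M q = fract_norm N q"
    using q by (simp add: fract_norm_Fract[OF assms(1)] eq_divide_eq)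
qed

text \<open>
  Elements of \<open>'n \<Rightarrow>\<^sub>0 nat\<close> are the monomials in variables indexed by the finite type
  \<open>'n\<close>, so \<open>('n, 'a) mpoly\<close> is the polynomial ring over \<open>'a\<close> in \<open>d = CARD('n) > 0\<close>
  variables, its multiplication being that of \<^theory>\<open>HOL-Library.Poly_Mapping\<close>.
\<close>

type_synonym ('n, 'a) mpoly = "('n \<Rightarrow>\<^sub>0 nat) \<Rightarrow>\<^sub>0 'a"

definition eval_mpoly :: "('n::finite, 'a::comm_semiring_1) mpoly \<Rightarrow> 'a ^ 'n \<Rightarrow> 'a" where
  "eval_mpoly p x =
     (\<Sum>m\<in>Poly_Mapping.keys p.
        Poly_Mapping.lookup p m * (\<Prod>i\<in>UNIV. (x $ i) ^ Poly_Mapping.lookup m i))"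

text \<open>The zero polynomial is homogeneous of every degree.\<close>

definition homogeneous_mpoly :: "nat \<Rightarrow> ('n::finite, 'a::zero) mpoly \<Rightarrow> bool" where
  "homogeneous_mpoly k p \<longleftrightarrow>
     (\<forall>m\<in>Poly_Mapping.keys p. (\<Sum>i\<in>UNIV. Poly_Mapping.lookup m i) = k)"

definition fract_mpoly :: "('n, 'a::idom) mpoly \<Rightarrow> ('n, 'a fract) mpoly" where
  "fract_mpoly p = Poly_Mapping.map to_fract p"

definition fract_vec :: "'a::idom ^ 'n \<Rightarrow> 'a fract ^ 'n" where
  "fract_vec x = (\<chi> i. to_fract (x $ i))"

definition euclidean_form :: "('a::idom \<Rightarrow> nat) \<Rightarrow> ('n::finite, 'a) mpoly \<Rightarrow> bool" where
  "euclidean_form N g \<longleftrightarrow>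
     (\<exists>k. homogeneous_mpoly k g) \<and>
     (\<forall>x. (\<forall>z. x \<noteq> fract_vec z) \<longrightarrow>
        (\<exists>y. 0 < fract_norm N (eval_mpoly (fract_mpoly g) (x - fract_vec y)) \<and>
             fract_norm N (eval_mpoly (fract_mpoly g) (x - fract_vec y)) < 1))"

end

theory Submission
  imports Defs
begin

text \<open>
  The proof is a descent on denominators, in the manner of the theorem of Aubry, Davenport and
  Cassels. Let \<open>x\<close> be a zero of \<open>f\<close> in \<open>K\<^sup>d\<close>, and choose \<open>t \<noteq> 0\<close> in \<open>R\<close> such that \<open>t x\<close> has its
  coordinates in \<open>R\<close>. If \<open>x\<close> is not in \<open>R\<^sup>d\<close>, then there is \<open>y\<close> in \<open>R\<^sup>d\<close> such that
  \<open>a = f2 (x - y)\<close> has norm strictly between 0 and 1. On the line through \<open>y\<close> and \<open>x\<close> the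
  polynomial \<open>f\<close> becomes a quadratic polynomial in one parameter with leading coefficient
  \<open>a \<noteq> 0\<close>. One of its roots belongs to \<open>x\<close>; the other one belongs to a point
  \<open>x'\<close> of \<open>K\<^sup>d\<close> for which \<open>t' = t a\<close> is a denominator. This \<open>t'\<close> lies in \<open>R\<close>, it is not 0, and its
  norm is smaller than that of \<open>t\<close>. Since norms are natural numbers, the process reaches
  a zero in \<open>R\<^sup>d\<close>.

  The step from \<open>x\<close> to \<open>x'\<close> is \<open>smaller_denominator\<close>. It depends on a form of the expansion of
  \<open>f\<close> along a line, \<open>eval_quadratic_on_line\<close>, in which the middle coefficient is written in terms
  of values of \<open>f\<close> and \<open>f2\<close>. This makes it evident that the coefficient lies in \<open>R\<close> when the
  points do, and it involves no division by 2, so that the characteristic does not matter.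
\<close>

section \<open>The embedding of the ring in its field of fractions\<close>

lemma to_fract_simps [simp]:
  "to_fract 0 = 0" "to_fract 1 = 1"
  "to_fract (a + b) = to_fract a + to_fract b"
  "to_fract (a - b) = to_fract a - to_fract b"
  "to_fract (- a) = - to_fract a"
  "to_fract (a * b) = to_fract a * to_fract b"
  "to_fract a = to_fract b \<longleftrightarrow> a = b"
  by (simp_all add: to_fract_def Zero_fract_def One_fract_def eq_fract)

lemma to_fract_eq_0_iff [simp]: "to_fract a = 0 \<longleftrightarrow> a = 0"
  using to_fract_simps(7)[of a 0] by simp

lemma to_fract_power: "to_fract (a ^ k) = to_fract a ^ k"
  by (induction k) simp_all

lemma to_fract_sum: "to_fract (sum g A) = (\<Sum>i\<in>A. to_fract (g i))"
  by (induction A rule: infinite_finite_induct) simp_all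

lemma to_fract_prod: "to_fract (prod g A) = (\<Prod>i\<in>A. to_fract (g i))"
  by (induction A rule: infinite_finite_induct) simp_all

lemma fract_vec_simps:
  "fract_vec (x + y) = fract_vec x + fract_vec y"
  "fract_vec (x - y) = fract_vec x - fract_vec y"
  "fract_vec (a *s x) = to_fract a *s fract_vec x"
  by (simp_all add: vec_eq_iff fract_vec_def)

lemma common_denominator:
  fixes x :: "'a::idom fract ^ 'n::finite"
  obtains t w where "t \<noteq> 0" and "to_fract t *s x = fract_vec w"
proof -
  have "\<exists>b a. b \<noteq> 0 \<and> to_fract b * x $ i = to_fract a" for i
  proof -
    obtain a b where "x $ i = Fract a b" "b \<noteq> 0"
      by (metis Fract_cases)
    then show ?thesis
      by (intro exI[of _ b] exI[of _ a]) (simp add: to_fract_def eq_fract)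
  qed
  then obtain b a where ba: "\<And>i. b i \<noteq> 0" "\<And>i. to_fract (b i) * x $ i = to_fract (a i)"
    by metis
  define t where "t = (\<Prod>i\<in>UNIV. b i)"
  define w where "w = (\<chi> i. (\<Prod>j\<in>UNIV - {i}. b j) * a i)"
  have split: "t = (\<Prod>j\<in>UNIV - {i}. b j) * b i" for i
    unfolding t_def by (subst prod.remove[of _ i]) (simp_all add: mult.commute)
  have "to_fract t * x $ i = to_fract (w $ i)" for i
    unfolding split[of i] by (simp add: w_def mult.assoc ba(2))
  then show thesis
    using that[of t w] ba(1) by (simp add: t_def vec_eq_iff fract_vec_def)
qed

section \<open>Evaluation of polynomials\<close>

lemma eval_mpoly_superset:
  assumes "finite A" and "Poly_Mapping.keys p \<subseteq> A"
  shows "eval_mpoly p x =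
    (\<Sum>m\<in>A. Poly_Mapping.lookup p m * (\<Prod>i\<in>UNIV. (x $ i) ^ Poly_Mapping.lookup m i))"
  unfolding eval_mpoly_def
  using assms by (intro sum.mono_neutral_left) (auto simp: in_keys_iff)

lemma eval_mpoly_add: "eval_mpoly (p + q) x = eval_mpoly p x + eval_mpoly q x"
proof -
  let ?A = "Poly_Mapping.keys p \<union> Poly_Mapping.keys q"
  have "Poly_Mapping.keys (p + q) \<subseteq> ?A"
    by (rule Poly_Mapping.keys_add)
  then show ?thesis
    by (simp add: eval_mpoly_superset[of ?A] lookup_add distrib_right sum.distrib)
qed

lemma lookup_fract_mpoly:
  "Poly_Mapping.lookup (fract_mpoly p) m = to_fract (Poly_Mapping.lookup p m)"
  by (simp add: fract_mpoly_def Poly_Mapping.map.rep_eq when_def)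

lemma keys_fract_mpoly: "Poly_Mapping.keys (fract_mpoly p) = Poly_Mapping.keys p"
  by (auto simp: in_keys_iff lookup_fract_mpoly)

lemma fract_mpoly_add: "fract_mpoly (p + q) = fract_mpoly p + fract_mpoly q"
  by (rule poly_mapping_eqI) (simp add: lookup_fract_mpoly lookup_add)

lemma homogeneous_fract_mpoly: "homogeneous_mpoly k (fract_mpoly p) \<longleftrightarrow> homogeneous_mpoly k p"
  by (simp add: homogeneous_mpoly_def keys_fract_mpoly)

lemma eval_fract_mpoly: "eval_mpoly (fract_mpoly p) (fract_vec x) = to_fract (eval_mpoly p x)"
  by (simp add: eval_mpoly_def keys_fract_mpoly lookup_fract_mpoly fract_vec_def
      to_fract_sum to_fract_prod to_fract_power)

text \<open>
  Splitting off one variable at a time shows that, as a function, a monomial of degree 1 is a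
  coordinate and one of degree 2 is a product of two coordinates.
\<close>

lemma monomial_Suc:
  fixes m :: "'n::finite \<Rightarrow>\<^sub>0 nat"
  assumes "(\<Sum>i\<in>UNIV. Poly_Mapping.lookup m i) = Suc k"
  obtains j m' where "(\<Sum>i\<in>UNIV. Poly_Mapping.lookup m' i) = k"
    and "\<And>x :: 'a::comm_semiring_1 ^ 'n. (\<Prod>i\<in>UNIV. (x $ i) ^ Poly_Mapping.lookup m i) =
      x $ j * (\<Prod>i\<in>UNIV. (x $ i) ^ Poly_Mapping.lookup m' i)"
proof -
  obtain j where j: "Poly_Mapping.lookup m j > 0"
    using assms by (metis gr0I nat.distinct(1) sum.neutral)
  define m' where "m' = m - Poly_Mapping.single j 1"
  have m: "Poly_Mapping.lookup m i = (if i = j then 1 else 0) + Poly_Mapping.lookup m' i" for i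
    using j by (auto simp: m'_def lookup_minus lookup_single)
  show thesis
  proof (rule that)
    show "(\<Sum>i\<in>UNIV. Poly_Mapping.lookup m' i) = k"
      using assms by (simp add: m sum.distrib)
    show "(\<Prod>i\<in>UNIV. (x $ i) ^ Poly_Mapping.lookup m i) =
      x $ j * (\<Prod>i\<in>UNIV. (x $ i) ^ Poly_Mapping.lookup m' i)" for x :: "'a ^ 'n"
    proof -
      have "(\<Prod>i\<in>UNIV. (x $ i) ^ (if i = j then 1 else 0)) = (\<Prod>i\<in>UNIV. if i = j then x $ i else 1)"
        by (intro prod.cong) auto
      then show ?thesis
        by (simp add: m power_add prod.distrib)
    qed
  qed
qed

lemma eval_homogeneous_0:
  assumes "homogeneous_mpoly 0 p"
  shows "eval_mpoly p x = eval_mpoly p y"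
  using assms by (auto simp: eval_mpoly_def homogeneous_mpoly_def intro!: sum.cong)

lemma eval_homogeneous_1:
  fixes v :: "'a::comm_ring_1 ^ 'n::finite"
  assumes "homogeneous_mpoly 1 p"
  shows "eval_mpoly p (y + s *s v) = eval_mpoly p y + s * (eval_mpoly p (y + v) - eval_mpoly p y)"
proof -
  let ?M = "\<lambda>m (x :: 'a ^ 'n). \<Prod>i\<in>UNIV. (x $ i) ^ Poly_Mapping.lookup m i"
  have "?M m (y + s *s v) = ?M m y + s * (?M m (y + v) - ?M m y)"
    if "m \<in> Poly_Mapping.keys p" for m
  proof -
    have "(\<Sum>i\<in>UNIV. Poly_Mapping.lookup m i) = Suc 0"
      using assms that by (auto simp: homogeneous_mpoly_def)
    then obtain j m' where "(\<Sum>i\<in>UNIV. Poly_Mapping.lookup m' i) = 0"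
      and m: "\<And>x. ?M m x = x $ j * ?M m' x"
      by (metis monomial_Suc)
    then have M: "?M m x = x $ j" for x
      by simp
    show ?thesis
      unfolding M by simp
  qed
  then have "eval_mpoly p (y + s *s v) = (\<Sum>m\<in>Poly_Mapping.keys p.
      Poly_Mapping.lookup p m * (?M m y + s * (?M m (y + v) - ?M m y)))"
    unfolding eval_mpoly_def by (intro sum.cong) simp_all
  then show ?thesis
    by (simp add: eval_mpoly_def algebra_simps sum.distrib sum_subtractf sum_distrib_left)
qed

text \<open>
  The coefficient of \<open>s\<close> is the polar form of \<open>p\<close> at \<open>y\<close> and \<open>v\<close>. Both sides are linear in \<open>p\<close>, which
  reduces the identity to the case of a product of two coordinates.
\<close>

lemma eval_homogeneous_2:
  fixes v :: "'a::comm_ring_1 ^ 'n::finite"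
  assumes "homogeneous_mpoly 2 p"
  shows "eval_mpoly p (y + s *s v) =
    eval_mpoly p y + s * (eval_mpoly p (y + v) - eval_mpoly p y - eval_mpoly p v)
      + s\<^sup>2 * eval_mpoly p v"
proof -
  let ?M = "\<lambda>m (x :: 'a ^ 'n). \<Prod>i\<in>UNIV. (x $ i) ^ Poly_Mapping.lookup m i"
  have "?M m (y + s *s v) = ?M m y + s * (?M m (y + v) - ?M m y - ?M m v) + s\<^sup>2 * ?M m v"
    if "m \<in> Poly_Mapping.keys p" for m
  proof -
    have "(\<Sum>i\<in>UNIV. Poly_Mapping.lookup m i) = Suc (Suc 0)"
      using assms that by (auto simp: homogeneous_mpoly_def)
    then obtain j m' where m': "(\<Sum>i\<in>UNIV. Poly_Mapping.lookup m' i) = Suc 0"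
      and m: "\<And>x. ?M m x = x $ j * ?M m' x"
      by (metis monomial_Suc)
    from m' obtain k m'' where "(\<Sum>i\<in>UNIV. Poly_Mapping.lookup m'' i) = 0"
      and "\<And>x. ?M m' x = x $ k * ?M m'' x"
      by (metis monomial_Suc)
    with m have M: "?M m x = x $ j * x $ k" for x
      by simp
    show ?thesis
      unfolding M by (simp add: algebra_simps power2_eq_square)
  qed
  then have "eval_mpoly p (y + s *s v) = (\<Sum>m\<in>Poly_Mapping.keys p. Poly_Mapping.lookup p m *
      (?M m y + s * (?M m (y + v) - ?M m y - ?M m v) + s\<^sup>2 * ?M m v))"
    unfolding eval_mpoly_def by (intro sum.cong) simp_all
  then show ?thesis
    by (simp add: eval_mpoly_def algebra_simps sum.distrib sum_subtractf sum_distrib_left)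
qed

text \<open>
  In degree 1 the analogous coefficient of \<open>s\<close> is \<open>f1 (y + v) - f1 y\<close>, and in degree 0 it vanishes;
  adding up, the three coefficients combine to one expression in \<open>f\<close> and \<open>f2\<close>.
\<close>

lemma eval_quadratic_on_line:
  fixes v :: "'a::comm_ring_1 ^ 'n::finite"
  assumes "f = f2 + f1 + f0"
    and "homogeneous_mpoly 2 f2" and "homogeneous_mpoly 1 f1" and "homogeneous_mpoly 0 f0"
  shows "eval_mpoly f (y + s *s v) =
    eval_mpoly f y + s * (eval_mpoly f (y + v) - eval_mpoly f y - eval_mpoly f2 v)
      + s\<^sup>2 * eval_mpoly f2 v"
  unfolding assms(1) eval_mpoly_add eval_homogeneous_2[OF assms(2)]
    eval_homogeneous_1[OF assms(3)] eval_homogeneous_0[OF assms(4), of "y + _" y]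
  by (simp add: algebra_simps)

lemma eval_homogeneous_scale:
  assumes "homogeneous_mpoly k p"
  shows "eval_mpoly p (s *s v) = s ^ k * eval_mpoly p v"
  unfolding eval_mpoly_def sum_distrib_left
proof (intro sum.cong refl)
  fix m
  assume "m \<in> Poly_Mapping.keys p"
  then have "(\<Prod>i\<in>UNIV. s ^ Poly_Mapping.lookup m i) = s ^ k"
    using assms by (simp add: homogeneous_mpoly_def flip: power_sum)
  then show "Poly_Mapping.lookup p m * (\<Prod>i\<in>UNIV. ((s *s v) $ i) ^ Poly_Mapping.lookup m i) =
      s ^ k * (Poly_Mapping.lookup p m * (\<Prod>i\<in>UNIV. (v $ i) ^ Poly_Mapping.lookup m i))"
    by (simp add: power_mult_distrib prod.distrib ac_simps)
qed

section \<open>Descent on the denominator\<close>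

text \<open>
  With \<open>u = t (x - y)\<close>, which has coordinates in \<open>R\<close>, the expansion of \<open>f\<close> along the line reads
  \<open>f (y + s u) = c + P s + f2 u s\<^sup>2\<close> with all coefficients in \<open>R\<close>, and \<open>f2 u = t\<^sup>2 a\<close> for
  \<open>a = f2 (x - y)\<close>. The point \<open>x\<close> belongs to the root \<open>s = 1 / t\<close>. Multiplying \<open>f x = 0\<close> by \<open>t\<close> gives
  \<open>t a = - (t c + P)\<close>, so \<open>t' = t a\<close> lies in \<open>R\<close>, although \<open>a\<close> in general does not. The product of
  the roots is \<open>c / (t\<^sup>2 a)\<close>, so the other root is \<open>c / t'\<close>, and the corresponding point has
  denominator \<open>t'\<close>.
\<close>

lemma smaller_denominator:
  fixes N :: "'a::idom \<Rightarrow> nat" and f f2 f1 f0 :: "('n::finite, 'a) mpoly"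
  assumes N: "discrete_mult_norm N"
    and f: "f = f2 + f1 + f0"
      "homogeneous_mpoly 2 f2" "homogeneous_mpoly 1 f1" "homogeneous_mpoly 0 f0"
    and t: "t \<noteq> 0" "to_fract t *s x = fract_vec w"
    and zero: "eval_mpoly (fract_mpoly f) x = 0"
    and y: "0 < fract_norm N (eval_mpoly (fract_mpoly f2) (x - fract_vec y))"
      "fract_norm N (eval_mpoly (fract_mpoly f2) (x - fract_vec y)) < 1"
  obtains t' x' w' where "t' \<noteq> 0" and "to_fract t' *s x' = fract_vec w'"
    and "eval_mpoly (fract_mpoly f) x' = 0" and "N t' < N t"
proof -
  let ?F = "eval_mpoly (fract_mpoly f)" and ?F2 = "eval_mpoly (fract_mpoly f2)"
  define u where "u = w - t *s y"
  define c where "c = eval_mpoly f y"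
  define P where "P = eval_mpoly f (y + u) - c - eval_mpoly f2 u"
  define a where "a = ?F2 (x - fract_vec y)"
  \<comment> \<open>Given by the expression that visibly lies in the ring; it equals \<open>t a\<close> by \<open>t'_eq\<close> below.\<close>
  define t' where "t' = - (t * c + P)"
  let ?t = "to_fract t" and ?t' = "to_fract t'"
  have t0: "?t \<noteq> 0"
    using t(1) by simp
  have u: "fract_vec u = ?t *s (x - fract_vec y)"
    by (simp add: u_def fract_vec_simps flip: t(2)) (simp add: vec_eq_iff algebra_simps)
  have F2u: "to_fract (eval_mpoly f2 u) = ?t\<^sup>2 * a"
    unfolding a_def eval_fract_mpoly[symmetric] u
    by (rule eval_homogeneous_scale) (simp add: homogeneous_fract_mpoly f)
  have line: "?F (fract_vec y + s *s fract_vec u) =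
      to_fract c + s * to_fract P + s\<^sup>2 * (?t\<^sup>2 * a)" for s
  proof -
    have "fract_mpoly f = fract_mpoly f2 + fract_mpoly f1 + fract_mpoly f0"
      by (simp add: f fract_mpoly_add)
    from eval_quadratic_on_line[OF this f(2-4)[THEN homogeneous_fract_mpoly[THEN iffD2]],
        of "fract_vec y" s "fract_vec u"]
    show ?thesis
      unfolding fract_vec_simps(1)[symmetric] eval_fract_mpoly F2u
      by (simp only: c_def P_def to_fract_simps F2u)
  qed
  have "fract_vec y + (1 / ?t) *s fract_vec u = x"
    using t0 by (simp add: u vec_eq_iff)
  then have "to_fract c + (1 / ?t) * to_fract P + (1 / ?t)\<^sup>2 * (?t\<^sup>2 * a) = 0"
    using zero line[of "1 / ?t"] by simp
  then have "?t * to_fract c + to_fract P + ?t * a = 0"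
    using t0 by (simp add: field_simps power2_eq_square)
  then have t'_eq: "?t' = ?t * a"
    by (simp add: t'_def add_eq_0_iff)
  have norm_t': "fract_norm N ?t' = of_nat (N t) * fract_norm N a"
    by (simp add: t'_eq fract_norm_mult[OF N] fract_norm_to_fract[OF N])
  have Nt: "N t > 0"
    using N t(1) unfolding discrete_mult_norm_def by (metis gr0I)
  have t'0: "?t' \<noteq> 0"
  proof
    assume "?t' = 0"
    then have "a = 0"
      using t'_eq t0 by simp
    moreover have "fract_norm N (to_fract 0) = 0"
      using N unfolding fract_norm_to_fract[OF N] discrete_mult_norm_def by simp
    ultimately show False
      using y(1) by (simp add: a_def)
  qed
  \<comment> \<open>If \<open>c = 0\<close>, then this is the point \<open>y\<close> itself; the argument covers that case.\<close>
  define x' where "x' = fract_vec y + (to_fract c / ?t') *s fract_vec u"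
  show thesis
  proof (rule that)
    show "t' \<noteq> 0"
      using t'0 by simp
    show "?t' *s x' = fract_vec (t' *s y + c *s u)"
      using t'0 by (simp add: x'_def fract_vec_simps vec_eq_iff distrib_left)
    have "?F x' = to_fract c + to_fract c / ?t' * to_fract P + (to_fract c / ?t')\<^sup>2 * (?t * ?t')"
      by (simp add: x'_def line t'_eq power2_eq_square)
    also have "\<dots> = to_fract c / ?t' * (?t' + to_fract P + ?t * to_fract c)"
      using t'0 by (simp add: field_simps power2_eq_square)
    also have "?t' + to_fract P + ?t * to_fract c = 0"
      by (simp add: t'_def)
    finally show "?F x' = 0"
      by simp
    have "of_nat (N t) * fract_norm N a < (of_nat (N t) :: rat)"
      using y(2) Nt by (simp add: a_def)
    then show "N t' < N t"
      using norm_t' by (simp add: fract_norm_to_fract[OF N])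
  qed
qed

theorem theorem1:
  fixes N :: "'a::idom \<Rightarrow> nat"
    and f f2 f1 f0 :: "('n::finite, 'a) mpoly"
  assumes "discrete_mult_norm N"
    and "f = f2 + f1 + f0"
    and "homogeneous_mpoly 2 f2"
    and "homogeneous_mpoly 1 f1"
    and "homogeneous_mpoly 0 f0"
    and "euclidean_form N f2"
    and "\<exists>x :: 'a fract ^ 'n. eval_mpoly (fract_mpoly f) x = 0"
  shows "\<exists>x :: 'a ^ 'n. eval_mpoly f x = 0"
proof -
  have descent: "\<exists>z. eval_mpoly f z = 0"
    if "t \<noteq> 0" "to_fract t *s x = fract_vec w" "eval_mpoly (fract_mpoly f) x = 0" for t x w
    using that
  proof (induction "N t" arbitrary: t x w rule: less_induct)
    case less
    show ?case
    proof (cases "\<exists>z. x = fract_vec z")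
      case True
      then show ?thesis
        using less.prems(3) by (auto simp: eval_fract_mpoly)
    next
      case False
      then obtain y where "0 < fract_norm N (eval_mpoly (fract_mpoly f2) (x - fract_vec y))"
        "fract_norm N (eval_mpoly (fract_mpoly f2) (x - fract_vec y)) < 1"
        using assms(6) unfolding euclidean_form_def by blast
      from smaller_denominator[OF assms(1-5) less.prems this] show ?thesis
        using less.hyps by metis
    qed
  qed
  obtain x :: "'a fract ^ 'n" where x: "eval_mpoly (fract_mpoly f) x = 0"
    using assms(7) by blast
  obtain t w where "t \<noteq> 0" "to_fract t *s x = fract_vec w"
    by (rule common_denominator)
  then show ?thesis
    using descent x by blast
qed

end
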